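(* Every countably generated self-dual Hilbert module $V$ over a unital $C^*$-algebra $A$ has the property (mBS2).
   Context: Hilbert modules are right Hilbert $C^*$-modules, with $A$-valued inner product $\langle\cdot,\cdot\rangle$ that is $A$-linear in the second variable. A Hilbert $A$-module $V$ is countably generated if there is a sequence in $V$ whose finite $A$-linear combinations are norm-dense in $V$. $V$ is self-dual if every bounded $A$-linear map $f:V\to A$ is of the form $f=\langle x,\cdot\rangle$ for some $x\in V$. The topology $\tau_{\widehat V}$ on $V$ is the locally convex topology generated by the seminorms $x\mapsto\|\langle z,x\rangle\|$, $z\in V$. A sequence $\{x_n\}$ in $V$ is called $\tau_{\widehat V}$-convergent if for every $z\in V$ the sequence $\{\langle z,x_n\rangle\}$ converges in norm in $A$ (so the limit may lie in the completion of $V$ with respect to $\tau_{\widehat V}$, not necessarily in $V$). (mBS2): every $\tau_{\widehat V}$-convergent sequence $\{x_n\}$ in $V$ admits a subsequence $\{x_{n(i)}\}$ such that the sequence $\frac1k\sum_{i=1}^k x_{n(i)}$, $k\in\mathbb N$, converges in norm (to an element of $V$). *)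

theory Defs
  imports "HOL-Analysis.Analysis"
begin

class complex_vector = real_vector +
  fixes scaleC :: "complex \<Rightarrow> 'a \<Rightarrow> 'a"  (infixr "*\<^sub>C" 75)
  assumes scaleC_add_right: "c *\<^sub>C (x + y) = c *\<^sub>C x + c *\<^sub>C y"
    and scaleC_add_left: "(c + d) *\<^sub>C x = c *\<^sub>C x + d *\<^sub>C x"
    and scaleC_scaleC: "c *\<^sub>C d *\<^sub>C x = (c * d) *\<^sub>C x"
    and scaleC_one: "1 *\<^sub>C x = x"
    and scaleC_of_real: "complex_of_real r *\<^sub>C x = r *\<^sub>R x"

class complex_normed_vector = complex_vector + real_normed_vector +
  assumes norm_scaleC: "norm (c *\<^sub>C x) = cmod c * norm x"

class cstar_algebra = complex_normed_vector + real_normed_algebra + banach +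
  fixes star :: "'a \<Rightarrow> 'a"
  assumes mult_scaleC_left: "(c *\<^sub>C x) * y = c *\<^sub>C (x * y)"
    and mult_scaleC_right: "x * (c *\<^sub>C y) = c *\<^sub>C (x * y)"
    and star_add: "star (x + y) = star x + star y"
    and star_scaleC: "star (c *\<^sub>C x) = cnj c *\<^sub>C star x"
    and star_mult: "star (x * y) = star y * star x"
    and star_star: "star (star x) = x"
    and cstar_identity: "norm (star x * x) = (norm x)\<^sup>2"

text \<open>The unit is added through \<^class>\<open>monoid_mult\<close> and not through \<^class>\<open>ring_1\<close>,
  whose axiom \<open>0 \<noteq> 1\<close> would exclude the zero algebra.\<close>

class unital_cstar_algebra = cstar_algebra + monoid_mult

definition spectrum :: "'a::unital_cstar_algebra \<Rightarrow> complex set" where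
  "spectrum a = {c. \<not> (\<exists>b. (c *\<^sub>C 1 - a) * b = 1 \<and> b * (c *\<^sub>C 1 - a) = 1)}"

definition positive :: "'a::unital_cstar_algebra \<Rightarrow> bool" where
  "positive a \<longleftrightarrow> star a = a \<and> spectrum a \<subseteq> complex_of_real ` {0..}"

text \<open>Right Hilbert modules: \<open>act x a\<close> is the right action \<open>x a\<close> and \<open>ip\<close> is the inner product.
  The assumption \<open>norm_ip\<close> says that the complete norm of \<open>'v\<close> is the one induced by \<open>ip\<close>.\<close>

locale hilbert_module =
  fixes act :: "'v::{complex_normed_vector, banach} \<Rightarrow> 'a::unital_cstar_algebra \<Rightarrow> 'v"
    and ip :: "'v \<Rightarrow> 'v \<Rightarrow> 'a"
  assumes act_add_left: "act (x + y) a = act x a + act y a"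
    and act_add_right: "act x (a + b) = act x a + act x b"
    and act_mult: "act x (a * b) = act (act x a) b"
    and act_one: "act x 1 = x"
    and act_scaleC_left: "act (c *\<^sub>C x) a = c *\<^sub>C act x a"
    and act_scaleC_right: "act x (c *\<^sub>C a) = c *\<^sub>C act x a"
    and ip_add_right: "ip x (y + z) = ip x y + ip x z"
    and ip_scaleC_right: "ip x (c *\<^sub>C y) = c *\<^sub>C ip x y"
    and ip_act_right: "ip x (act y a) = ip x y * a"
    and ip_star: "star (ip x y) = ip y x"
    and ip_positive: "positive (ip x x)"
    and ip_definite: "ip x x = 0 \<Longrightarrow> x = 0"
    and norm_ip: "norm x = sqrt (norm (ip x x))"

definition countably_generated ::
    "('v::real_normed_vector \<Rightarrow> 'a::unital_cstar_algebra \<Rightarrow> 'v) \<Rightarrow> bool" where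
  "countably_generated act \<longleftrightarrow>
     (\<exists>g :: nat \<Rightarrow> 'v. closure {\<Sum>i<n. act (g i) (a i) | n a. True} = UNIV)"

text \<open>Real-linearity and compatibility with the action of the unital algebra already give
  complex linearity, since \<open>act x (c *\<^sub>C 1) = c *\<^sub>C x\<close>.\<close>

definition bounded_module_map ::
    "('v::real_normed_vector \<Rightarrow> 'a::unital_cstar_algebra \<Rightarrow> 'v) \<Rightarrow> ('v \<Rightarrow> 'a) \<Rightarrow> bool" where
  "bounded_module_map act f \<longleftrightarrow> bounded_linear f \<and> (\<forall>x a. f (act x a) = f x * a)"

definition self_dual ::
    "('v::real_normed_vector \<Rightarrow> 'a::unital_cstar_algebra \<Rightarrow> 'v) \<Rightarrow> ('v \<Rightarrow> 'v \<Rightarrow> 'a) \<Rightarrow> bool" where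
  "self_dual act ip \<longleftrightarrow> (\<forall>f. bounded_module_map act f \<longrightarrow> (\<exists>x. f = ip x))"

text \<open>No limit in \<open>'v\<close> is required: the limit of the sequence may lie in the completion of \<open>'v\<close>
  for the topology generated by the seminorms \<open>\<lambda>x. norm (ip z x)\<close>.\<close>

definition tau_convergent ::
    "('v \<Rightarrow> 'v \<Rightarrow> 'a::unital_cstar_algebra) \<Rightarrow> (nat \<Rightarrow> 'v) \<Rightarrow> bool" where
  "tau_convergent ip x \<longleftrightarrow> (\<forall>z. convergent (\<lambda>n. ip z (x n)))"

text \<open>Subsequences are indexed from 0; the mean of the first \<open>k = 0\<close> terms is \<open>0\<close> and
  does not affect convergence.\<close>

definition mBS2 :: "('v::real_normed_vector \<Rightarrow> 'v \<Rightarrow> 'a::unital_cstar_algebra) \<Rightarrow> bool" where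
  "mBS2 ip \<longleftrightarrow>
     (\<forall>x. tau_convergent ip x \<longrightarrow>
        (\<exists>r :: nat \<Rightarrow> nat. strict_mono r \<and>
           convergent (\<lambda>k. (1 / real k) *\<^sub>R (\<Sum>i<k. x (r i)))))"

end

theory Submission
  imports Defs
begin

text \<open>Let \<open>x\<^sub>n\<close> be \<open>\<tau>\<close>-convergent. By the uniform boundedness principle \<open>(x\<^sub>n)\<close> is bounded and
  \<open>z \<mapsto> lim \<langle>x\<^sub>n, z\<rangle>\<close> is a bounded module map, so self-duality provides a limit \<open>x\<close> in \<open>V\<close>.
  As in the classical Banach--Saks argument for Hilbert spaces, \<open>y\<^sub>n = x\<^sub>n - x\<close> has a subsequence
  of almost orthogonal vectors; the squared norm of its \<open>k\<close>-th partial sum grows at most linearly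
  in \<open>k\<close>, so its means tend to \<open>0\<close>.\<close>

section \<open>Uniform boundedness by Baire category\<close>

theorem banach_steinhaus:
  fixes f :: "'i \<Rightarrow> 'a::banach \<Rightarrow> 'b::real_normed_vector"
  assumes lin: "\<And>i. bounded_linear (f i)"
    and bdd: "\<And>x. \<exists>B. \<forall>i. norm (f i x) \<le> B"
  shows "\<exists>M\<ge>0. \<forall>i x. norm (f i x) \<le> M * norm x"
proof -
  \<comment> \<open>By Baire, one of these closed sets contains a ball, since together they cover
    the complete space.\<close>
  define E where "E m = {x. \<forall>i. norm (f i x) \<le> real m}" for m
  have closed_E: "closed (E m)" for m
    unfolding E_def by (intro closed_Collect_all closed_Collect_le continuous_intros
        linear_continuous_on lin)
  have union_E: "(\<Union>m. E m) = UNIV"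
  proof safe
    fix x
    obtain B where "\<forall>i. norm (f i x) \<le> B"
      using bdd by blast
    moreover obtain m where "B \<le> real m"
      using real_arch_simple by blast
    ultimately show "x \<in> (\<Union>m. E m)"
      unfolding E_def by (auto intro: order_trans)
  qed auto
  have "\<exists>m. interior (E m) \<noteq> {}"
  proof (rule ccontr)
    assume "\<not> ?thesis"
    then have "euclidean interior_of \<Union>(range E) = {}"
      using Met_TC.metric_Baire_category_alt[of "range E"] closed_E complete_UNIV
      by (auto simp: interior_of_def interior_def)
    then show False
      using union_E by simp
  qed
  then obtain m a where "a \<in> interior (E m)"
    by blast
  then obtain e where e: "e > 0" "cball a e \<subseteq> E m"
    by (meson mem_interior_cball)
  have "norm (f i x) \<le> (2 * real m / e) * norm x" for i x
  proof (cases "x = 0")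
    case True
    then show ?thesis
      using lin[of i] by (simp add: linear_simps)
  next
    case False
    interpret bounded_linear "f i" by (rule lin)
    \<comment> \<open>Scaling \<open>x\<close> to length \<open>e\<close> keeps
      \<open>a + t *\<^sub>R x\<close> in the ball. Subtracting the value at the centre then bounds
      \<open>f i\<close> on \<open>t *\<^sub>R x\<close> by \<open>2 * m\<close>, whatever
      \<open>i\<close> is.\<close>
    define t where "t = e / norm x"
    have t: "t > 0"
      using False e by (simp add: t_def)
    have "a + t *\<^sub>R x \<in> cball a e" "a \<in> cball a e"
      using False e by (auto simp: t_def dist_norm)
    then have "norm (f i (a + t *\<^sub>R x)) \<le> m" "norm (f i a) \<le> m"
      using e unfolding E_def by blast+
    moreover have "norm (t *\<^sub>R f i x) \<le> norm (f i (a + t *\<^sub>R x)) + norm (f i a)"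
      using norm_triangle_ineq4[of "f i (a + t *\<^sub>R x)" "f i a"] by (simp add: add scaleR)
    ultimately have "t * norm (f i x) \<le> 2 * m"
      using t by simp
    then show ?thesis
      using False e by (simp add: t_def field_simps)
  qed
  moreover have "2 * real m / e \<ge> 0"
    using e by simp
  ultimately show ?thesis
    by blast
qed

section \<open>Norm estimates for the involution and the inner product\<close>

lemma norm_star [simp]: "norm (star a) = norm (a::'a::cstar_algebra)"
proof -
  \<comment> \<open>The C*-identity and submultiplicativity give one inequality; applied to
    \<open>star a\<close> it gives the other.\<close>
  have le: "norm b \<le> norm (star b)" for b :: 'a
  proof (cases "b = 0")
    case False
    have "norm b * norm b \<le> norm (star b) * norm b"
      using norm_mult_ineq[of "star b" b] by (simp add: cstar_identity power2_eq_square)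
    with False show ?thesis by simp
  qed simp
  show ?thesis
    using le[of a] le[of "star a"] by (simp add: star_star)
qed

context hilbert_module
begin

lemma norm_ip_self: "norm (ip x x) = (norm x)\<^sup>2"
  by (simp add: norm_ip)

lemma norm_ip_commute: "norm (ip x y) = norm (ip y x)"
  using norm_star[of "ip y x"] by (simp add: ip_star)

lemma ip_add_left: "ip (x + y) z = ip x z + ip y z"
  by (metis ip_star ip_add_right star_add)

lemma ip_scaleC_left: "ip (c *\<^sub>C x) y = cnj c *\<^sub>C ip x y"
  by (metis ip_star ip_scaleC_right star_scaleC)

lemma linear_ip: "linear (ip x)"
  by (intro linearI) (simp_all add: ip_add_right ip_scaleC_right flip: scaleC_of_real)

lemma ip_diff_right: "ip x (y - z) = ip x y - ip x z"
  by (rule linear_diff[OF linear_ip])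

lemma ip_scaleR_left: "ip (r *\<^sub>R x) y = r *\<^sub>R ip x y"
  by (simp add: ip_scaleC_left flip: scaleC_of_real)

lemma ip_minus_left: "ip (- x) y = - ip x y"
  using ip_scaleR_left[of "-1" x y] by simp

lemma ip_diff_left: "ip (x - y) z = ip x z - ip y z"
  using ip_add_left[of x "- y" z] by (simp add: ip_minus_left)

lemma ip_sum_left: "ip (\<Sum>i\<in>I. f i) y = (\<Sum>i\<in>I. ip (f i) y)"
  using ip_scaleR_left[of 0 0 y]
  by (induction I rule: infinite_finite_induct) (simp_all add: ip_add_left)

text \<open>Polarization replaces the Cauchy--Schwarz inequality at the cost of a factor: unlike the
  sharp bound, it does not need monotonicity of the norm on positive elements.\<close>

lemma norm_ip_le: "norm (ip x y) \<le> 6 * norm x * norm y"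
proof -
  have sym: "norm (ip x y + ip y x) \<le> 6" if "norm x = 1" "norm y = 1" for x y
  proof -
    have "ip x y + ip y x = ip (x + y) (x + y) - ip x x - ip y y"
      by (simp add: ip_add_left ip_add_right)
    then have "norm (ip x y + ip y x) \<le> norm (ip (x + y) (x + y)) + norm (ip x x) + norm (ip y y)"
      by (smt (verit) norm_triangle_ineq4)
    \<comment> \<open>For unit vectors this is \<open>4 + 1 + 1\<close>, the source of the constant
      6.\<close>
    also have "\<dots> \<le> (norm x + norm y)\<^sup>2 + (norm x)\<^sup>2 + (norm y)\<^sup>2"
      by (simp add: norm_ip_self norm_triangle_ineq power_mono)
    finally show ?thesis
      using that by simp
  qed
  have unit: "norm (ip x y) \<le> 6" if "norm x = 1" "norm y = 1" for x y
  proof -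
    \<comment> \<open>Passing from \<open>y\<close> to the unit vector
      \<open>\<i> *\<^sub>C y\<close> turns the sum bounded by \<open>sym\<close> into the
      difference, up to a factor of modulus 1. Sum and difference together recover
      \<open>ip x y\<close>.\<close>
    have "ip x (\<i> *\<^sub>C y) + ip (\<i> *\<^sub>C y) x = \<i> *\<^sub>C (ip x y - ip y x)"
      using scaleC_add_right[of \<i> "ip x y" "(-1) *\<^sub>C ip y x"] scaleC_of_real[of "-1" "ip y x"]
      by (simp add: ip_scaleC_left ip_scaleC_right scaleC_scaleC)
    then have "norm (ip x y - ip y x) \<le> 6"
      using sym[of x "\<i> *\<^sub>C y"] that by (simp add: norm_scaleC)
    moreover have "2 *\<^sub>R ip x y = (ip x y + ip y x) + (ip x y - ip y x)"
      by (simp add: scaleR_2)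
    ultimately have "norm (2 *\<^sub>R ip x y) \<le> 12"
      using sym[OF that] by (smt (verit) norm_triangle_ineq)
    then show ?thesis by simp
  qed
  show ?thesis
  proof (cases "x = 0 \<or> y = 0")
    case True
    then show ?thesis
      using ip_scaleR_left[of 0 0 y] linear_0[OF linear_ip, of x] by auto
  next
    case False
    define u v where "u = (1 / norm x) *\<^sub>R x" and "v = (1 / norm y) *\<^sub>R y"
    have "ip x y = (norm x * norm y) *\<^sub>R ip u v"
      using False by (simp add: u_def v_def ip_scaleR_left linear_scale[OF linear_ip])
    moreover have "norm (ip u v) \<le> 6"
      using False by (intro unit) (simp_all add: u_def v_def)
    ultimately show ?thesis
      using mult_left_mono[of "norm (ip u v)" 6 "norm x * norm y"] by (simp add: mult_ac)
  qed
qed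

lemma bounded_linear_ip: "bounded_linear (ip x)"
proof -
  interpret linear "ip x" by (rule linear_ip)
  show ?thesis
    by unfold_locales (metis norm_ip_le mult.commute mult.assoc)
qed

section \<open>Boundedness and limits of \<tau>-convergent sequences\<close>

lemma tau_convergent_bounded:
  assumes "tau_convergent ip x"
  obtains M where "\<And>n. norm (x n) \<le> M"
proof -
  have "\<exists>B. \<forall>n. norm (ip (x n) z) \<le> B" for z
    using assms convergent_imp_Bseq[of "\<lambda>n. ip z (x n)"]
    unfolding tau_convergent_def Bseq_def by (metis norm_ip_commute)
  then obtain M where M: "M \<ge> 0" "\<And>n z. norm (ip (x n) z) \<le> M * norm z"
    using banach_steinhaus[of "\<lambda>n. ip (x n)"] bounded_linear_ip by blast
  \<comment> \<open>Testing the uniform bound at \<open>z = x n\<close> gives the squared norm on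
    the left, so one factor cancels.\<close>
  have "norm (x n) \<le> M" for n
  proof (cases "x n = 0")
    case False
    then show ?thesis
      using M(2)[of n "x n"] by (simp add: norm_ip_self power2_eq_square)
  qed (use M in simp)
  with that show ?thesis by blast
qed

lemma self_dual_tau_limit:
  assumes "self_dual act ip" and conv: "tau_convergent ip x"
  obtains v where "\<And>z. (\<lambda>n. ip z (x n)) \<longlonglongrightarrow> ip z v"
proof -
  obtain M where M: "\<And>n. norm (x n) \<le> M"
    using tau_convergent_bounded[OF conv] by blast
  \<comment> \<open>The sequence stands in the first argument because the inner product is
    \<open>A\<close>-linear in the second. Convergence carries over from the other order because the
    involution is isometric.\<close>
  define f where "f z = lim (\<lambda>n. ip (x n) z)" for z
  have tendsto_f: "(\<lambda>n. ip (x n) z) \<longlonglongrightarrow> f z" for z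
  proof -
    have "Cauchy (\<lambda>n. ip z (x n))"
      using conv by (simp add: tau_convergent_def Cauchy_convergent_iff)
    moreover have "dist (ip (x m) z) (ip (x n) z) = dist (ip z (x m)) (ip z (x n))" for m n
      using norm_ip_commute[of "x m - x n" z] by (simp add: dist_norm ip_diff_left ip_diff_right)
    ultimately have "Cauchy (\<lambda>n. ip (x n) z)"
      by (simp add: Cauchy_def)
    then show ?thesis
      unfolding f_def by (simp add: Cauchy_convergent_iff convergent_LIMSEQ_iff)
  qed
  have "bounded_linear f"
  proof (rule bounded_linear_intro)
    fix z w r
    show "f (z + w) = f z + f w"
      using tendsto_add[OF tendsto_f[of z] tendsto_f[of w]]
      by (intro LIMSEQ_unique[OF tendsto_f]) (simp add: ip_add_right)
    show "f (r *\<^sub>R z) = r *\<^sub>R f z"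
      using tendsto_scaleR[OF tendsto_const tendsto_f[of z], of r]
      by (intro LIMSEQ_unique[OF tendsto_f]) (simp add: linear_scale[OF linear_ip])
    have "norm (ip (x n) z) \<le> norm z * (6 * M)" for n
    proof -
      have "norm (ip (x n) z) \<le> (6 * norm z) * norm (x n)"
        using norm_ip_le[of "x n" z] by (simp add: mult_ac)
      also have "\<dots> \<le> (6 * norm z) * M"
        by (intro mult_left_mono M) simp
      finally show ?thesis by (simp add: mult_ac)
    qed
    then show "norm (f z) \<le> norm z * (6 * M)"
      by (intro LIMSEQ_le_const2[OF tendsto_norm[OF tendsto_f]]) blast
  qed
  moreover have "f (act z a) = f z * a" for z a
    using tendsto_mult[OF tendsto_f[of z] tendsto_const[of a]]
    by (intro LIMSEQ_unique[OF tendsto_f]) (simp add: ip_act_right)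
  ultimately obtain v where v: "f = ip v"
    using assms(1) unfolding self_dual_def bounded_module_map_def by blast
  have "(\<lambda>n. ip z (x n)) \<longlonglongrightarrow> ip z v" for z
  proof -
    have "norm (ip z (x n) - ip z v) = norm (ip (x n) z - ip v z)" for n
      using norm_ip_commute[of z "x n - v"] by (simp add: ip_diff_left ip_diff_right)
    moreover have "(\<lambda>n. norm (ip (x n) z - ip v z)) \<longlonglongrightarrow> 0"
      using tendsto_f[of z] unfolding v by (intro tendsto_norm_zero LIM_zero)
    ultimately have "(\<lambda>n. norm (ip z (x n) - ip z v)) \<longlonglongrightarrow> 0"
      by presburger
    then show ?thesis
      by (rule LIM_zero_cancel[OF tendsto_norm_zero_cancel])
  qed
  then show ?thesis by (rule that)
qed

section \<open>The Banach--Saks argument\<close>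

lemma norm_add_squared_le:
  "(norm (x + y))\<^sup>2 \<le> (norm x)\<^sup>2 + 2 * norm (ip x y) + (norm y)\<^sup>2"
proof -
  have "ip (x + y) (x + y) = ip x x + ip x y + ip y x + ip y y"
    by (simp add: ip_add_left ip_add_right)
  then have "norm (ip (x + y) (x + y)) \<le> norm (ip x x) + norm (ip x y) + norm (ip y x) + norm (ip y y)"
    by (metis norm_triangle_mono norm_triangle_ineq order_refl)
  then show ?thesis
    by (simp add: norm_ip_self norm_ip_commute[of y x])
qed

text \<open>Each new index is taken so far out that its \<open>k\<close> inner products with the
  earlier vectors are at most \<open>1 / k\<close> each.\<close>

lemma almost_orthogonal_subseq:
  assumes "\<And>z. (\<lambda>n. ip z (y n)) \<longlonglongrightarrow> 0"
  obtains r :: "nat \<Rightarrow> nat" where "strict_mono r"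
    "\<And>k. norm (ip (\<Sum>i<k. y (r i)) (y (r k))) \<le> 1"
proof -
  \<comment> \<open>Controlling all indices up to \<open>m\<close>, not only the selected ones,
    makes the next index a function of the current one, so that \<open>r\<close> arises by iterating
    \<open>N\<close>.\<close>
  have "\<exists>n>m. \<forall>i\<le>m. norm (ip (y i) (y n)) < 1 / real (Suc m)" for m
  proof -
    have "\<forall>\<^sub>F n in sequentially. norm (ip (y i) (y n)) < 1 / real (Suc m)" for i
      by (intro order_tendstoD(2)[OF tendsto_norm_zero[OF assms]]) simp
    then have "\<forall>\<^sub>F n in sequentially. \<forall>i\<in>{..m}. norm (ip (y i) (y n)) < 1 / real (Suc m)"
      by (intro eventually_ball_finite) auto
    with eventually_gt_at_top[of m]
    have "\<forall>\<^sub>F n in sequentially. n > m \<and> (\<forall>i\<le>m. norm (ip (y i) (y n)) < 1 / real (Suc m))"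
      by eventually_elim auto
    then show ?thesis
      by (auto simp: eventually_sequentially)
  qed
  then obtain N where N: "\<And>m. m < N m"
      "\<And>i m. i \<le> m \<Longrightarrow> norm (ip (y i) (y (N m))) < 1 / real (Suc m)"
    by metis
  define r where "r k = (N ^^ k) 0" for k
  have r_Suc: "r (Suc k) = N (r k)" for k
    by (simp add: r_def)
  have mono: "strict_mono r"
    by (simp add: strict_mono_Suc_iff r_Suc N)
  have "norm (ip (\<Sum>i<k. y (r i)) (y (r k))) \<le> 1" for k
  proof (cases k)
    case 0
    then show ?thesis
      using ip_sum_left[of y "{}" "y (r 0)"] by simp
  next
    case (Suc j)
    have "norm (ip (y (r i)) (y (r k))) \<le> 1 / real k" if "i < k" for i
    proof -
      \<comment> \<open>The second inequality trades the bound in terms of \<open>r j\<close> for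
        one in terms of \<open>k = Suc j\<close>.\<close>
      have "r i \<le> r j" "j \<le> r j"
        using that Suc mono by (simp_all add: strict_mono_less_eq seq_suble)
      then have "norm (ip (y (r i)) (y (r k))) \<le> 1 / real (Suc (r j))"
        using N(2) Suc by (simp add: r_Suc less_imp_le)
      also have "\<dots> \<le> 1 / real k"
        using \<open>j \<le> r j\<close> Suc by (simp add: frac_le)
      finally show ?thesis .
    qed
    then have "norm (ip (\<Sum>i<k. y (r i)) (y (r k))) \<le> of_nat (card {..<k}) * (1 / real k)"
      unfolding ip_sum_left by (intro order_trans[OF norm_sum] sum_bounded_above) simp
    then show ?thesis
      using Suc by simp
  qed
  with mono that show ?thesis by blast
qed

lemma means_tendsto_0:
  assumes M: "\<And>n. norm (y n) \<le> M"
    and orth: "\<And>k. norm (ip (\<Sum>i<k. y i) (y k)) \<le> 1"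
  shows "(\<lambda>k. (1 / real k) *\<^sub>R (\<Sum>i<k. y i)) \<longlonglongrightarrow> 0"
proof -
  \<comment> \<open>Adding one vector raises the squared norm by at most \<open>M\<^sup>2\<close>
    from the vector itself and 2 from the two cross terms.\<close>
  define C where "C = M\<^sup>2 + 2"
  have growth: "(norm (\<Sum>i<k. y i))\<^sup>2 \<le> real k * C" for k
  proof (induction k)
    case (Suc k)
    have "(norm (y k))\<^sup>2 \<le> M\<^sup>2"
      by (intro power_mono M) simp
    then show ?case
      using Suc norm_add_squared_le[of "\<Sum>i<k. y i" "y k"] orth[of k]
      by (simp add: C_def algebra_simps)
  qed simp
  have "norm ((1 / real k) *\<^sub>R (\<Sum>i<k. y i)) \<le> sqrt (C / real k)" for k
  proof (cases "k = 0")
    case False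
    have "norm ((1 / real k) *\<^sub>R (\<Sum>i<k. y i)) = sqrt ((norm (\<Sum>i<k. y i))\<^sup>2 / (real k)\<^sup>2)"
      by (simp add: real_sqrt_divide)
    also have "\<dots> \<le> sqrt (C / real k)"
      using False growth[of k] by (simp add: field_simps power2_eq_square)
    finally show ?thesis .
  qed simp
  moreover have "(\<lambda>k. sqrt (C / real k)) \<longlonglongrightarrow> 0"
    using tendsto_real_sqrt[OF lim_const_over_n[of C]] by simp
  ultimately show ?thesis
    by (rule Lim_null_comparison[OF always_eventually[OF allI]])
qed

end

theorem corollary6p7:
  fixes act :: "'v::{complex_normed_vector, banach} \<Rightarrow> 'a::unital_cstar_algebra \<Rightarrow> 'v"
    and ip :: "'v \<Rightarrow> 'v \<Rightarrow> 'a"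
  assumes "hilbert_module act ip"
    and "countably_generated act"
    and "self_dual act ip"
  shows "mBS2 ip"
  unfolding mBS2_def
proof (intro allI impI)
  interpret hilbert_module act ip by (rule assms)
  fix x :: "nat \<Rightarrow> 'v"
  assume conv: "tau_convergent ip x"
  obtain v where v: "\<And>z. (\<lambda>n. ip z (x n)) \<longlonglongrightarrow> ip z v"
    using self_dual_tau_limit[OF assms(3) conv] by blast
  define y where "y n = x n - v" for n
  have y_0: "(\<lambda>n. ip z (y n)) \<longlonglongrightarrow> 0" for z
    using v[of z] by (simp add: y_def ip_diff_right LIM_zero)
  obtain M where M: "\<And>n. norm (x n) \<le> M"
    using tau_convergent_bounded[OF conv] by blast
  have bounded_y: "norm (y n) \<le> M + norm v" for n
    using norm_triangle_ineq4[of "x n" v] M[of n] by (simp add: y_def)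
  obtain r :: "nat \<Rightarrow> nat" where r: "strict_mono r" "\<And>k. norm (ip (\<Sum>i<k. y (r i)) (y (r k))) \<le> 1"
    using almost_orthogonal_subseq[OF y_0] by blast
  have "(\<lambda>k. v + (1 / real k) *\<^sub>R (\<Sum>i<k. y (r i))) \<longlonglongrightarrow> v + 0"
    by (rule tendsto_add[OF tendsto_const means_tendsto_0[OF bounded_y r(2)]])
  \<comment> \<open>The two sides may differ at \<open>k = 0\<close>, where the left one is
    \<open>v\<close> and the right one is 0.\<close>
  moreover have "\<forall>\<^sub>F k in sequentially. v + (1 / real k) *\<^sub>R (\<Sum>i<k. y (r i))
      = (1 / real k) *\<^sub>R (\<Sum>i<k. x (r i))"
    using eventually_gt_at_top[of 0]
    by eventually_elim
       (simp add: y_def sum_subtractf scaleR_diff_right sum_constant_scaleR)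
  ultimately have "(\<lambda>k. (1 / real k) *\<^sub>R (\<Sum>i<k. x (r i))) \<longlonglongrightarrow> v"
    by (simp add: tendsto_cong)
  with r(1) show "\<exists>r. strict_mono r \<and> convergent (\<lambda>k. (1 / real k) *\<^sub>R (\<Sum>i<k. x (r i)))"
    by (auto simp: convergent_def)
qed

end
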